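(* Let $L>2$ be irrational, let $S,S'$ be dense countable subsets of $\mathbb{S}_L$ and let $p,p'\in(0,1)$. Suppose that $G=G_{L,S,p}$ and $G'=G_{L,S',p'}$ can be coupled so that $G\cong G'$ with positive probability. Then $S$ and $S'$ differ by an isometry of $\mathbb{S}_L$, i.e. there is an isometry $\varphi$ of $\mathbb{S}_L$ with $\varphi(S)=S'$.
   Context: $\mathbb{S}_L:=\mathbb{R}/L\mathbb{Z}$ is the circle of circumference $L$ with intrinsic metric $\|u-v\|=\min\{|u-v|,L-|u-v|\}$. For a dense countable $S\subset\mathbb{S}_L$ and $p\in(0,1)$, $G_{L,S,p}$ is the random graph with vertex set $S$ in which each pair $u,v\in S$ with $\|u-v\|<1$ is joined by an edge with probability $p$, independently over pairs, and pairs with $\|u-v\|\ge1$ are never joined. $\cong$ denotes graph isomorphism. *)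

theory Defs
  imports "HOL-Probability.Probability"
begin

text \<open>
  Points of $\mathbb{R}/L\mathbb{Z}$ are represented by their unique representative in $[0,L)$.
  The formula for the metric is meaningful only for such representatives: for arbitrary reals
  it can be negative.
\<close>

definition circle :: "real \<Rightarrow> real set" where
  "circle L = {0..<L}"

definition circle_dist :: "real \<Rightarrow> real \<Rightarrow> real \<Rightarrow> real" where
  "circle_dist L u v = min \<bar>u - v\<bar> (L - \<bar>u - v\<bar>)"

definition dense_in_circle :: "real \<Rightarrow> real set \<Rightarrow> bool" where
  "dense_in_circle L S \<longleftrightarrow>
     S \<subseteq> circle L \<and> (\<forall>x\<in>circle L. \<forall>\<epsilon>>0. \<exists>s\<in>S. circle_dist L x s < \<epsilon>)"

definition circle_isometry :: "real \<Rightarrow> (real \<Rightarrow> real) \<Rightarrow> bool" where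
  "circle_isometry L \<phi> \<longleftrightarrow>
     bij_betw \<phi> (circle L) (circle L) \<and>
     (\<forall>u\<in>circle L. \<forall>v\<in>circle L. circle_dist L (\<phi> u) (\<phi> v) = circle_dist L u v)"

text \<open>A graph is a pair of a vertex set and a set of edges, each edge being a two-element set of
  vertices.\<close>

type_synonym 'a graph = "'a set \<times> 'a set set"

abbreviation verts :: "'a graph \<Rightarrow> 'a set" where "verts \<equiv> fst"
abbreviation edges :: "'a graph \<Rightarrow> 'a set set" where "edges \<equiv> snd"

definition graph_iso :: "'a graph \<Rightarrow> 'b graph \<Rightarrow> bool" where
  "graph_iso G H \<longleftrightarrow>
     (\<exists>f. bij_betw f (verts G) (verts H) \<and>
          (\<forall>u\<in>verts G. \<forall>v\<in>verts G. {u, v} \<in> edges G \<longleftrightarrow> {f u, f v} \<in> edges H))"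

definition close_pairs :: "real \<Rightarrow> real set \<Rightarrow> real set set" where
  "close_pairs L S = {{u, v} | u v. u \<in> S \<and> v \<in> S \<and> u \<noteq> v \<and> circle_dist L u v < 1}"

text \<open>
  \<open>geometric_random_graph M L S p G\<close> says that the random graph \<open>G\<close>, defined on the probability
  space \<open>M\<close>, is a copy of $G_{L,S,p}$. Independence and the edge probability determine the joint
  law of the edge indicators. Hence two such graphs, for the parameters \<open>(L, S, p)\<close> and
  \<open>(L, S', p')\<close>, on one common space \<open>M\<close> are exactly a coupling of $G_{L,S,p}$ and
  $G_{L,S',p'}$. Measurability of the edge events is part of \<open>prob_space.indep_events\<close>.
\<close>

definition geometric_random_graph ::
    "'w measure \<Rightarrow> real \<Rightarrow> real set \<Rightarrow> real \<Rightarrow> ('w \<Rightarrow> real graph) \<Rightarrow> bool" where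
  "geometric_random_graph M L S p G \<longleftrightarrow>
     prob_space M \<and>
     (\<forall>\<omega>\<in>space M. verts (G \<omega>) = S \<and> edges (G \<omega>) \<subseteq> close_pairs L S) \<and>
     prob_space.indep_events M (\<lambda>e. {\<omega>\<in>space M. e \<in> edges (G \<omega>)}) (close_pairs L S) \<and>
     (\<forall>e\<in>close_pairs L S. measure M {\<omega>\<in>space M. e \<in> edges (G \<omega>)} = p)"

text \<open>
  Isomorphism of countable graphs is an analytic relation that need not be Borel, so the event that
  two random graphs are isomorphic need not lie in \<open>sets M\<close>. It does lie in the completion of \<open>M\<close>,
  where its probability is its outer measure. The plain \<open>measure\<close> of a set outside \<open>sets M\<close> would
  be 0 by convention.
\<close>

definition prob_iso :: "'w measure \<Rightarrow> ('w \<Rightarrow> 'a graph) \<Rightarrow> ('w \<Rightarrow> 'b graph) \<Rightarrow> ennreal" where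
  "prob_iso M G H = outer_measure_of M {\<omega>\<in>space M. graph_iso (G \<omega>) (H \<omega>)}"

end

theory Submission
  imports Defs "HOL-Library.Real_Mod" "HOL-Analysis.Kronecker_Approximation_Theorem"
begin

text \<open>
  Almost surely every finite set of vertices within distance less than 1 of a vertex \<open>x\<close> has common
  neighbours arbitrarily close to \<open>x\<close>. For two graphs with this property, a compactness argument
  shows that an isomorphism \<open>f\<close> maps points at distance less than 1 to points at distance at most 1,
  and so does its inverse. The radii \<open>r\<close> with this property in place of 1 are closed
  under \<open>r + s\<close>, \<open>r - s\<close> and \<open>L - r - s\<close>, so they contain the distance of every natural number to
  \<open>L\<int>\<close>. Since \<open>L\<close> is irrational, these radii are dense in \<open>[0, L / 2]\<close>, hence \<open>f\<close> is an isometry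
  between dense subsets of the circle and extends.
\<close>

section \<open>The norm on the circle\<close>

text \<open>The distance from \<open>x\<close> to the nearest multiple of \<open>L\<close>. Unlike
  \<open>circle_dist\<close> it is meaningful for all reals, so points can be added, subtracted and
  negated without first being reduced to [0, L).\<close>

definition circle_norm :: "real \<Rightarrow> real \<Rightarrow> real" where
  "circle_norm L x = \<bar>x - of_int (round (x / L)) * L\<bar>"

locale circle_length =
  fixes L :: real
  assumes L_pos: "0 < L"
begin

abbreviation nrm :: "real \<Rightarrow> real" where "nrm \<equiv> circle_norm L"

text \<open>\<open>round\<close> picks an integer closest to \<open>x / L\<close>, and scaling by
  \<open>L\<close> preserves the comparison. With \<open>nrm_attained\<close> this makes
  \<open>nrm x\<close> a minimum over all integers \<open>k\<close>, which is how most of the later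
  proofs handle it.\<close>

lemma nrm_le: "nrm x \<le> \<bar>x - of_int k * L\<bar>"
proof -
  have "\<bar>x / L - of_int (round (x / L))\<bar> * L \<le> \<bar>x / L - of_int k\<bar> * L"
    using L_pos by (intro mult_right_mono round_diff_minimal) auto
  moreover have "\<bar>x / L - of_int m\<bar> * L = \<bar>x - of_int m * L\<bar>" for m
  proof -
    have "\<bar>x / L - of_int m\<bar> * L = \<bar>(x / L - of_int m) * L\<bar>"
      using L_pos by (simp add: abs_mult)
    also have "(x / L - of_int m) * L = x - of_int m * L"
      using L_pos by (simp add: field_simps)
    finally show ?thesis .
  qed
  ultimately show ?thesis
    by (simp add: circle_norm_def)
qed

lemma nrm_attained: obtains k :: int where "nrm x = \<bar>x - of_int k * L\<bar>"
  by (auto simp: circle_norm_def)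

lemma nrm_nonneg [simp]: "0 \<le> nrm x"
  by (simp add: circle_norm_def)

lemma nrm_le_abs: "nrm x \<le> \<bar>x\<bar>"
  using nrm_le[of x 0] by simp

lemma nrm_0 [simp]: "nrm 0 = 0"
  by (simp add: circle_norm_def)

lemma nrm_le_half: "nrm x \<le> L / 2"
proof -
  have "\<bar>of_int (round (x / L)) - x / L\<bar> * L \<le> 1 / 2 * L"
    using L_pos by (intro mult_right_mono of_int_round_abs_le) auto
  moreover have "\<bar>of_int (round (x / L)) - x / L\<bar> * L = nrm x"
    using L_pos unfolding circle_norm_def
    by (subst abs_minus_commute) (auto simp: abs_mult_pos' field_simps)
  ultimately show ?thesis by simp
qed

lemma nrm_triangle: "nrm (x + y) \<le> nrm x + nrm y"
proof -
  obtain j where "nrm x = \<bar>x - of_int j * L\<bar>" by (rule nrm_attained)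
  moreover obtain k where "nrm y = \<bar>y - of_int k * L\<bar>" by (rule nrm_attained)
  moreover have "nrm (x + y) \<le> \<bar>x + y - of_int (j + k) * L\<bar>" by (rule nrm_le)
  ultimately show ?thesis by (simp add: algebra_simps)
qed

lemma nrm_uminus [simp]: "nrm (- x) = nrm x"
proof -
  have "nrm (- x) \<le> nrm x" for x
  proof -
    obtain k where "nrm x = \<bar>x - of_int k * L\<bar>" by (rule nrm_attained)
    moreover have "nrm (- x) \<le> \<bar>- x - of_int (- k) * L\<bar>" by (rule nrm_le)
    ultimately show ?thesis by simp
  qed
  from this[of x] this[of "- x"] show ?thesis by simp
qed

lemma nrm_minus_commute: "nrm (x - y) = nrm (y - x)"
  using nrm_uminus[of "x - y"] by simp

lemma nrm_triangle3: "nrm (x - z) \<le> nrm (x - y) + nrm (y - z)"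
  using nrm_triangle[of "x - y" "y - z"] by simp

lemma nrm_rcong: assumes "[x = y] (rmod L)" shows "nrm x = nrm y"
proof -
  have "nrm x \<le> nrm y" if "[x = y] (rmod L)" for x y
  proof -
    from that obtain n where n: "y = x + of_int n * L" by (auto simp: rcong_altdef)
    obtain k where "nrm y = \<bar>y - of_int k * L\<bar>" by (rule nrm_attained)
    moreover have "nrm x \<le> \<bar>x - of_int (k - n) * L\<bar>" by (rule nrm_le)
    ultimately show ?thesis by (simp add: n algebra_simps)
  qed
  with assms rcong_sym[OF assms] show ?thesis by (meson order_antisym)
qed

lemma nrm_representative: obtains e where "[x = e] (rmod L)" "\<bar>e\<bar> = nrm x"
proof -
  obtain k where "nrm x = \<bar>x - of_int k * L\<bar>" by (rule nrm_attained)
  moreover have "[x = x - of_int k * L] (rmod L)"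
    unfolding rcong_altdef by (rule exI[of _ "- k"]) simp
  ultimately show ?thesis using that by metis
qed

text \<open>Representatives of least absolute value agree up to sign. The sign left open here is the
  orientation that has to be settled when an isometry is extended.\<close>

lemma nrm_eq_imp_rcong:
  assumes "nrm x = nrm y" shows "[x = y] (rmod L) \<or> [x = - y] (rmod L)"
proof -
  obtain e where e: "[x = e] (rmod L)" "\<bar>e\<bar> = nrm x" by (rule nrm_representative)
  obtain f where f: "[y = f] (rmod L)" "\<bar>f\<bar> = nrm y" by (rule nrm_representative)
  from e f assms have "e = f \<or> e = - f" by auto
  then show ?thesis
    using e(1) rcong_sym[OF f(1)] rcong_uminus[OF rcong_sym[OF f(1)]]
    by (metis rcong_trans)
qed

lemma nrm_eq_0_iff: "nrm x = 0 \<longleftrightarrow> [x = 0] (rmod L)"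
  using nrm_eq_imp_rcong[of x 0] nrm_rcong[of x 0] by auto

lemma nrm_eq_abs: assumes "\<bar>x\<bar> \<le> L / 2" shows "nrm x = \<bar>x\<bar>"
proof (rule antisym[OF nrm_le_abs])
  obtain k where k: "nrm x = \<bar>x - of_int k * L\<bar>" by (rule nrm_attained)
  show "\<bar>x\<bar> \<le> nrm x"
  proof (cases "k = 0")
    case False
    then have "L \<le> \<bar>of_int k\<bar> * L"
      using L_pos by (intro mult_le_cancel_right1[THEN iffD2]) auto
    also have "\<dots> = \<bar>of_int k * L\<bar>" using L_pos by (simp add: abs_mult)
    finally show ?thesis using assms k by linarith
  qed (use k in simp)
qed

lemma nrm_greater: assumes "r < x" "x < L - r" shows "r < nrm x"
proof -
  obtain k where k: "nrm x = \<bar>x - of_int k * L\<bar>" by (rule nrm_attained)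
  show ?thesis
  proof (cases "k \<le> 0")
    case True
    then have "of_int k * L \<le> 0" using L_pos by (simp add: mult_le_0_iff)
    with assms k show ?thesis by linarith
  next
    case False
    then have "1 * L \<le> of_int k * L" using L_pos by (intro mult_right_mono) auto
    with assms k show ?thesis by linarith
  qed
qed

text \<open>A geodesic triangle has perimeter at most \<open>L\<close>. If the signed
  representatives \<open>e\<close>, \<open>f\<close> have equal signs, going round the circle the
  other way bounds the third side by L minus the first two; if the signs differ, the perimeter is at
  most twice the longer of the two sides, hence at most \<open>L\<close>.\<close>

lemma nrm_perimeter: "nrm x + nrm y + nrm (x + y) \<le> L"
proof -
  obtain e where e: "[x = e] (rmod L)" "\<bar>e\<bar> = nrm x" by (rule nrm_representative)
  obtain f where f: "[y = f] (rmod L)" "\<bar>f\<bar> = nrm y" by (rule nrm_representative)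
  have ef: "nrm (x + y) = nrm (e + f)" by (intro nrm_rcong rcong_add e f)
  have "nrm (e + f) \<le> \<bar>e + f\<bar>" "nrm (e + f) \<le> \<bar>e + f - L\<bar>" "nrm (e + f) \<le> \<bar>e + f + L\<bar>"
    using nrm_le[of "e + f" 0] nrm_le[of "e + f" 1] nrm_le[of "e + f" "- 1"] by simp_all
  with ef e(2) f(2) nrm_le_half[of x] nrm_le_half[of y] show ?thesis by linarith
qed

lemma nrm_perimeter3: "nrm (x - y) + nrm (y - z) + nrm (x - z) \<le> L"
  using nrm_perimeter[of "x - y" "y - z"] by simp

lemma abs_nrm_diff_le: "\<bar>nrm x - nrm y\<bar> \<le> nrm (x - y)"
  using nrm_triangle[of "x - y" y] nrm_triangle[of "y - x" x] nrm_minus_commute[of x y]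
  by (simp add: abs_le_iff)

lemma continuous_on_nrm: "continuous_on A nrm"
proof -
  have "\<bar>nrm x - nrm y\<bar> \<le> \<bar>x - y\<bar>" for x y
    using abs_nrm_diff_le[of x y] nrm_le_abs[of "x - y"] by simp
  then show ?thesis
    unfolding continuous_on_iff dist_real_def by (meson order_le_less_trans)
qed

section \<open>Points at prescribed distances from two given points\<close>

lemma nrm_offset: obtains s where "[v = u + s * nrm (v - u)] (rmod L)" "s = 1 \<or> s = - (1::real)"
proof -
  obtain e where e: "[v - u = e] (rmod L)" "\<bar>e\<bar> = nrm (v - u)" by (rule nrm_representative)
  have "[u + (v - u) = u + e] (rmod L)" using e(1) by (intro rcong_add) auto
  then have "[v = u + e] (rmod L)" by simp
  moreover have "e = 1 * nrm (v - u) \<or> e = - 1 * nrm (v - u)" using e(2) by auto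
  ultimately show ?thesis using that by metis
qed

text \<open>The point at signed distance \<open>e\<close> from \<open>u\<close> in the direction of \<open>v\<close>.\<close>

lemma nrm_point_towards:
  obtains w where "nrm (u - w) = nrm e" "nrm (v - w) = nrm (e - nrm (v - u))"
proof -
  obtain s where s: "[v = u + s * nrm (v - u)] (rmod L)" "s = 1 \<or> s = - (1::real)"
    by (rule nrm_offset)
  define w where "w = u + s * e"
  have "nrm (u - w) = nrm e"
    using s(2) by (auto simp: w_def)
  moreover have "nrm (v - w) = nrm (u + s * nrm (v - u) - w)"
    by (intro nrm_rcong rcong_diff s(1)) auto
  moreover have "u + s * nrm (v - u) - w = - s * (e - nrm (v - u))"
    by (simp add: w_def algebra_simps)
  then have "nrm (u + s * nrm (v - u) - w) = nrm (e - nrm (v - u))"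
    using s(2) nrm_minus_commute by auto
  ultimately show ?thesis using that by metis
qed

text \<open>Take the point at distance \<open>e\<close> from \<open>u\<close> on a shortest arc to
  \<open>v\<close>. The strict inequalities in the conclusion leave room to replace it by a nearby
  member of a dense family.\<close>

lemma nrm_point_between:
  assumes "nrm (u - v) < r + s" "0 < r" "0 < s"
  obtains w where "nrm (u - w) < r" "nrm (v - w) < s"
proof -
  define d where "d = nrm (v - u)"
  have d: "0 \<le> d" "d < r + s" using assms(1) by (simp_all add: d_def nrm_minus_commute)
  have "\<exists>e. 0 \<le> e \<and> e < r \<and> e \<le> d \<and> d - e < s"
  proof (cases "d < s")
    case True
    then show ?thesis using d assms by (intro exI[of _ 0]) auto
  next
    case False
    then have "d - s < min d r" using d assms by auto
    then obtain e where "d - s < e" "e < min d r" using dense by blast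
    then show ?thesis using d False by (intro exI[of _ e]) auto
  qed
  then obtain e where e: "0 \<le> e" "e < r" "e \<le> d" "d - e < s" by blast
  obtain w where w: "nrm (u - w) = nrm e" "nrm (v - w) = nrm (e - d)"
    unfolding d_def by (rule nrm_point_towards)
  have "nrm e < r" "nrm (e - d) < s"
    using e nrm_le_abs[of e] nrm_le_abs[of "e - d"] by simp_all
  with w that[of w] show ?thesis by simp
qed

text \<open>Continue a shortest arc from \<open>u\<close> to \<open>v\<close> past \<open>v\<close>
  by less than \<open>s\<close>. Staying short of the antipode, \<open>e < L / 2\<close>, ensures
  that the distance from \<open>u\<close> really is \<open>e\<close>.\<close>

lemma nrm_point_beyond:
  assumes "r - s < nrm (u - v)" "0 < s" "0 \<le> r" "r < L / 2"
  obtains w where "r < nrm (u - w)" "nrm (v - w) < s"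
proof (cases "r < nrm (u - v)")
  case True
  then show ?thesis using that[of v] assms by simp
next
  case False
  define d where "d = nrm (v - u)"
  have d: "0 \<le> d" "d \<le> r" "r < d + s"
    using assms(1) False by (simp_all add: d_def nrm_minus_commute)
  then have "r < min (d + s) (L / 2)" using assms by simp
  then obtain e where e: "r < e" "e < min (d + s) (L / 2)" using dense by blast
  obtain w where w: "nrm (u - w) = nrm e" "nrm (v - w) = nrm (e - d)"
    unfolding d_def by (rule nrm_point_towards)
  have "r < nrm e" using e assms by (subst nrm_eq_abs) auto
  moreover have "nrm (e - d) < s" using e d nrm_le_abs[of "e - d"] by simp
  ultimately show ?thesis using that[of w] w by simp
qed

lemma nrm_point_far:
  assumes "nrm (u - v) < L - r - s" "0 \<le> r" "r < L / 2" "0 \<le> s" "s < L / 2"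
  obtains w where "r < nrm (u - w)" "s < nrm (v - w)"
proof -
  define d where "d = nrm (v - u)"
  have d: "0 \<le> d" "d < L - r - s" using assms(1) by (simp_all add: d_def nrm_minus_commute)
  \<comment> \<open>With \<open>u\<close> at 0 and \<open>v\<close> at \<open>d\<close> on the line,
    the lower bounds put \<open>e\<close> beyond the closed balls of radius \<open>r\<close> and
    \<open>s\<close> around them, and the upper bounds put it before the copies of these balls
    shifted by \<open>L\<close>.\<close>
  then have "max r (d + s) < min (L - r) (d + L - s)" using assms by auto
  then obtain e where e: "max r (d + s) < e" "e < min (L - r) (d + L - s)" using dense by blast
  obtain w where w: "nrm (u - w) = nrm e" "nrm (v - w) = nrm (e - d)"
    unfolding d_def by (rule nrm_point_towards)
  have "r < nrm e" "s < nrm (e - d)" using e by (auto intro!: nrm_greater)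
  with w that[of w] show ?thesis by simp
qed

text \<open>A unit ball smaller than a half circle determines its centre: moving on from
  \<open>v\<close>, away from \<open>u\<close>, by less than 1 leads out of the closed unit ball
  around \<open>u\<close>.\<close>

lemma nrm_ball_inj:
  assumes "1 < L / 2" "nrm (u - v) \<noteq> 0"
  obtains w where "nrm (v - w) < 1" "1 < nrm (u - w)"
proof (rule nrm_point_beyond[of 1 1 u v])
  show "1 - 1 < nrm (u - v)"
    using assms(2) nrm_nonneg[of "u - v"] by linarith
qed (use assms that in auto)

section \<open>Comparison with the circle metric and with representatives in [0, L)\<close>

lemma circle_dist_eq_nrm:
  assumes "u \<in> circle L" "v \<in> circle L" shows "circle_dist L u v = nrm (u - v)"
proof -
  have uv: "\<bar>u - v\<bar> < L" using assms by (auto simp: circle_def)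
  show ?thesis
  proof (cases "\<bar>u - v\<bar> \<le> L / 2")
    case True
    then show ?thesis by (simp add: circle_dist_def nrm_eq_abs)
  next
    case False
    have "nrm (u - v) = nrm \<bar>u - v\<bar>" by (auto simp: abs_if nrm_minus_commute)
    also have "\<dots> = nrm (\<bar>u - v\<bar> - L)"
      by (intro nrm_rcong) (auto simp: rcong_altdef intro: exI[of _ "-1"])
    also have "\<dots> = L - \<bar>u - v\<bar>" using False uv by (subst nrm_eq_abs) auto
    finally show ?thesis using False by (simp add: circle_dist_def)
  qed
qed

lemma rmod_in_circle: "x rmod L \<in> circle L"
  using L_pos by (auto simp: circle_def rmod_nonneg rmod_less)

lemma circle_rcong_imp_eq:
  assumes "u \<in> circle L" "v \<in> circle L" "[u = v] (rmod L)" shows "u = v"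
  using assms by (intro rcong_imp_eq[OF assms(3)]) (auto simp: circle_def)

text \<open>Multiples of the irrational number \<open>1 / L\<close> are dense modulo 1 by
  Kronecker's theorem; scaling by \<open>L\<close> makes the natural numbers dense modulo
  \<open>L\<close>.\<close>

lemma nrm_approx:
  assumes irr: "L \<notin> \<rat>" and d: "0 \<le> d" "d < L / 2" and eps: "0 < \<epsilon>"
  obtains n :: nat where "d < nrm (real n)" "nrm (real n) < d + \<epsilon>"
proof -
  have "1 / L \<notin> \<rat>"
    using irr Rats_inverse[of "1 / L"] by (auto simp: inverse_eq_divide)
  \<comment> \<open>The window of radius \<delta> around d + \<delta> lies between \<open>d\<close>
    and both d + \<epsilon> and \<open>L / 2\<close>, and below \<open>L / 2\<close> a residue
    equals its norm.\<close>
  define \<delta> where "\<delta> = min \<epsilon> (L / 2 - d) / 2"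
  have \<delta>: "0 < \<delta>" "\<delta> < \<epsilon>" "d + 2 * \<delta> \<le> L / 2" "2 * \<delta> \<le> \<epsilon>"
    using d eps by (auto simp: \<delta>_def min_def field_simps)
  define \<alpha> where "\<alpha> = (d + \<delta>) / L"
  obtain k :: nat where k: "\<bar>frac (real k * (1 / L)) - \<alpha>\<bar> < \<delta> / L"
    using Kronecker_approx_1_explicit[OF \<open>1 / L \<notin> \<rat>\<close>, of \<alpha> "\<delta> / L"] d \<delta> L_pos
    by (auto simp: \<alpha>_def field_simps)
  have "\<bar>frac (real k * (1 / L)) - \<alpha>\<bar> * L < \<delta>"
    using k L_pos by (simp add: field_simps)
  moreover have "\<bar>frac (real k * (1 / L)) - \<alpha>\<bar> * L = \<bar>(frac (real k * (1 / L)) - \<alpha>) * L\<bar>"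
    using L_pos by (simp add: abs_mult)
  moreover have "(frac (real k * (1 / L)) - \<alpha>) * L = real k rmod L - (d + \<delta>)"
    using L_pos by (simp add: rmod_conv_frac \<alpha>_def field_simps)
  ultimately have close: "\<bar>real k rmod L - (d + \<delta>)\<bar> < \<delta>" by simp
  have "nrm (real k) = nrm (real k rmod L)" by (intro nrm_rcong) simp
  also have "\<dots> = real k rmod L"
    using close \<delta> d by (subst nrm_eq_abs) (auto simp: abs_less_iff)
  finally show ?thesis using that[of k] close \<delta> by (simp add: abs_less_iff)
qed

end

section \<open>Radii preserved by a map\<close>

context circle_length
begin

text \<open>An indexed family rather than a set: a bijection and its inverse then become the same
  pair of families \<open>x\<close>, \<open>y\<close> read in the two orders.\<close>

definition dense_family :: "'i set \<Rightarrow> ('i \<Rightarrow> real) \<Rightarrow> bool" where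
  "dense_family I x \<longleftrightarrow> (\<forall>z. \<forall>\<epsilon>>0. \<exists>i\<in>I. nrm (z - x i) < \<epsilon>)"

text \<open>Strict in the premise and weak in the conclusion, because the compactness argument
  yields only closed balls. The contrapositive \<open>ball_mapD'\<close> has the same shape.\<close>

definition ball_map :: "'i set \<Rightarrow> ('i \<Rightarrow> real) \<Rightarrow> ('i \<Rightarrow> real) \<Rightarrow> real \<Rightarrow> bool" where
  "ball_map I x y r \<longleftrightarrow> (\<forall>i\<in>I. \<forall>j\<in>I. nrm (x i - x j) < r \<longrightarrow> nrm (y i - y j) \<le> r)"

lemma dense_familyD:
  assumes "dense_family I x" "0 < \<epsilon>" obtains i where "i \<in> I" "nrm (z - x i) < \<epsilon>"
  using assms unfolding dense_family_def by blast

lemma ball_mapD: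
  "ball_map I x y r \<Longrightarrow> i \<in> I \<Longrightarrow> j \<in> I \<Longrightarrow> nrm (x i - x j) < r \<Longrightarrow> nrm (y i - y j) \<le> r"
  by (auto simp: ball_map_def)

lemma ball_mapD':
  "ball_map I x y r \<Longrightarrow> i \<in> I \<Longrightarrow> j \<in> I \<Longrightarrow> r < nrm (y i - y j) \<Longrightarrow> r \<le> nrm (x i - x j)"
  by (meson ball_mapD not_less)

section \<open>Closure of the preserved radii under arithmetic\<close>

lemma ball_map_trivial: "r \<le> 0 \<or> L / 2 \<le> r \<Longrightarrow> ball_map I x y r"
  unfolding ball_map_def by (meson nrm_le_half nrm_nonneg not_less order_trans)

text \<open>Density supplies an index \<open>k\<close> within \<open>r\<close> of \<open>i\<close>
  and within \<open>s\<close> of \<open>j\<close>; the triangle inequality is then applied to the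
  images.\<close>

lemma ball_map_add:
  assumes x: "dense_family I x" and r: "ball_map I x y r" "0 < r" and s: "ball_map I x y s" "0 < s"
  shows "ball_map I x y (r + s)"
  unfolding ball_map_def
proof (intro ballI impI)
  fix i j assume ij: "i \<in> I" "j \<in> I" "nrm (x i - x j) < r + s"
  obtain w where w: "nrm (x i - w) < r" "nrm (x j - w) < s"
    using nrm_point_between[OF ij(3) r(2) s(2)] by blast
  define \<epsilon> where "\<epsilon> = min (r - nrm (x i - w)) (s - nrm (x j - w))"
  have "0 < \<epsilon>" using w by (simp add: \<epsilon>_def)
  then obtain k where k: "k \<in> I" "nrm (w - x k) < \<epsilon>" using x by (blast elim: dense_familyD)
  have "nrm (x i - x k) < r" "nrm (x j - x k) < s"
    using nrm_triangle3[of "x i" "x k" w] nrm_triangle3[of "x j" "x k" w] k by (auto simp: \<epsilon>_def)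
  then have "nrm (y i - y k) \<le> r" "nrm (y j - y k) \<le> s"
    using r s ij k by (auto intro: ball_mapD)
  then show "nrm (y i - y j) \<le> r + s"
    using nrm_triangle3[of "y i" "y j" "y k"] nrm_minus_commute[of "y j" "y k"] by simp
qed

text \<open>If the image distance exceeded \<open>r - s\<close>, some \<open>y k\<close> within
  \<open>s\<close> of \<open>y j\<close> would be farther than \<open>r\<close> from
  \<open>y i\<close>. Pulling back, \<open>x k\<close> is at least \<open>r\<close> from
  \<open>x i\<close> but at most \<open>s\<close> from \<open>x j\<close>, against the triangle
  inequality.\<close>

lemma ball_map_diff:
  assumes y: "dense_family I y" and r: "ball_map I x y r" "0 \<le> r" "r < L / 2"
    and s: "ball_map I y x s" "0 < s"
  shows "ball_map I x y (r - s)"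
  unfolding ball_map_def
proof (intro ballI impI, rule ccontr)
  fix i j assume ij: "i \<in> I" "j \<in> I" "nrm (x i - x j) < r - s" and "\<not> nrm (y i - y j) \<le> r - s"
  then have "r - s < nrm (y i - y j)" by simp
  then obtain w where w: "r < nrm (y i - w)" "nrm (y j - w) < s"
    using nrm_point_beyond r s by blast
  define \<epsilon> where "\<epsilon> = min (nrm (y i - w) - r) (s - nrm (y j - w))"
  have "0 < \<epsilon>" using w by (simp add: \<epsilon>_def)
  then obtain k where k: "k \<in> I" "nrm (w - y k) < \<epsilon>" using y by (blast elim: dense_familyD)
  have "r < nrm (y i - y k)" "nrm (y j - y k) < s"
    using nrm_triangle3[of "y i" w "y k"] nrm_triangle3[of "y j" "y k" w] k
    by (auto simp: \<epsilon>_def nrm_minus_commute)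
  then have "r \<le> nrm (x i - x k)" "nrm (x j - x k) \<le> s"
    using ball_mapD'[OF r(1) ij(1) k(1)] ball_mapD[OF s(1) ij(2) k(1)] by auto
  then show False
    using ij nrm_triangle3[of "x i" "x k" "x j"] by simp
qed

text \<open>Choose \<open>x k\<close> farther than \<open>r\<close> from \<open>x i\<close> and
  farther than \<open>s\<close> from \<open>x j\<close>. The contrapositives of the reverse
  hypotheses carry this over to \<open>y\<close>, and the perimeter bound leaves at most
  \<open>L - r - s\<close> for the third side.\<close>

lemma ball_map_complement:
  assumes x: "dense_family I x" and r: "ball_map I y x r" "0 \<le> r" "r < L / 2"
    and s: "ball_map I y x s" "0 \<le> s" "s < L / 2"
  shows "ball_map I x y (L - r - s)"
  unfolding ball_map_def
proof (intro ballI impI)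
  fix i j assume ij: "i \<in> I" "j \<in> I" "nrm (x i - x j) < L - r - s"
  then obtain w where w: "r < nrm (x i - w)" "s < nrm (x j - w)"
    using nrm_point_far r s by blast
  define \<epsilon> where "\<epsilon> = min (nrm (x i - w) - r) (nrm (x j - w) - s)"
  have "0 < \<epsilon>" using w by (simp add: \<epsilon>_def)
  then obtain k where k: "k \<in> I" "nrm (w - x k) < \<epsilon>" using x by (blast elim: dense_familyD)
  have "r < nrm (x i - x k)" "s < nrm (x j - x k)"
    using nrm_triangle3[of "x i" w "x k"] nrm_triangle3[of "x j" w "x k"] k
    by (auto simp: \<epsilon>_def nrm_minus_commute)
  then have "r \<le> nrm (y i - y k)" "s \<le> nrm (y j - y k)"
    using ball_mapD'[OF r(1) ij(1) k(1)] ball_mapD'[OF s(1) ij(2) k(1)] by auto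
  then show "nrm (y i - y j) \<le> L - r - s"
    using nrm_perimeter3[of "y i" "y k" "y j"] nrm_minus_commute[of "y j" "y k"] by simp
qed

section \<open>Norms of natural numbers as preserved radii\<close>

lemma nrm_of_nat_less_half: assumes "L \<notin> \<rat>" shows "nrm (real n) < L / 2"
proof -
  obtain k where k: "nrm (real n) = \<bar>real n - of_int k * L\<bar>" by (rule nrm_attained)
  have "nrm (real n) \<noteq> L / 2"
  proof
    assume "nrm (real n) = L / 2"
    then have "\<bar>real n - of_int k * L\<bar> = L / 2" using k by simp
    \<comment> \<open>Oddness guarantees that \<open>m\<close> is nonzero when dividing by
      it.\<close>
    then obtain m :: int where "2 * real n = of_int m * L" "odd m"
    proof (cases "0 \<le> real n - of_int k * L")
      case True
      with \<open>\<bar>real n - of_int k * L\<bar> = L / 2\<close> show ?thesis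
        by (intro that[of "2 * k + 1"]) (auto simp: algebra_simps)
    next
      case False
      with \<open>\<bar>real n - of_int k * L\<bar> = L / 2\<close> show ?thesis
        by (intro that[of "2 * k - 1"]) (auto simp: algebra_simps)
    qed
    then have "L = 2 * real n / of_int m" by (auto simp: field_simps)
    then have "L \<in> \<rat>" by simp
    with assms show False by simp
  qed
  with nrm_le_half[of "real n"] show ?thesis by simp
qed

text \<open>A unit step from the signed representative \<open>e\<close> leads away from 0, towards
  0, across 0, or across the antipode. With \<open>r = nrm (real n)\<close> and \<open>s = 1\<close>
  the results are \<open>r + s\<close>, \<open>r - s\<close>, \<open>s - r\<close> and
  \<open>L - r - s\<close>, exactly the forms covered by the closure lemmas.\<close>

lemma nrm_Suc_cases:
  assumes "2 < L"
  obtains "nrm (real (Suc n)) = nrm (real n) + 1"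
    | "nrm (real (Suc n)) = nrm (real n) - 1"
    | "nrm (real (Suc n)) = 1 - nrm (real n)"
    | "nrm (real (Suc n)) = L - nrm (real n) - 1"
proof -
  obtain e where e: "[real n = e] (rmod L)" "\<bar>e\<bar> = nrm (real n)" by (rule nrm_representative)
  have eL: "\<bar>e\<bar> \<le> L / 2" using e nrm_le_half by simp
  have *: "nrm (real (Suc n)) = nrm (e + 1)"
    using nrm_rcong[OF rcong_add[OF e(1) rcong_refl[of 1]]] by (simp add: add.commute)
  show ?thesis
  proof (cases "e + 1 \<le> L / 2")
    case True
    then have "nrm (e + 1) = \<bar>e + 1\<bar>" using eL by (intro nrm_eq_abs) linarith
    with * e(2) that show ?thesis by linarith
  next
    case False
    have "nrm (e + 1) = nrm (e + 1 - L)"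
      by (intro nrm_rcong) (auto simp: rcong_altdef intro!: exI[of _ "-1"])
    also have "\<dots> = \<bar>e + 1 - L\<bar>" using eL False assms by (intro nrm_eq_abs) linarith
    finally show ?thesis using * e(2) that eL False assms by linarith
  qed
qed

text \<open>Both directions are carried through one induction, since differences and complements use
  radii preserved in the reverse direction.\<close>

lemma ball_map_nrm_of_nat:
  assumes L: "2 < L" "L \<notin> \<rat>" and dense: "dense_family I x" "dense_family I y"
    and one: "ball_map I x y 1" "ball_map I y x 1"
  shows "ball_map I x y (nrm (real n)) \<and> ball_map I y x (nrm (real n))"
proof (induction n)
  case 0
  then show ?case by (simp add: ball_map_trivial)
next
  case (Suc n)
  note half = nrm_of_nat_less_half[OF L(2), of n]
  show ?case
  \<comment> \<open>Radius 0 is treated separately because sums and subtracted radii must be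
    positive. The next norm is then 1, as \<open>L - 1\<close> would exceed
    \<open>L / 2\<close>.\<close>
  proof (cases "nrm (real n) = 0")
    case True
    have "nrm (real (Suc n)) = 1 \<or> nrm (real (Suc n)) = L - 1"
      using True nrm_Suc_cases[OF L(1), of n] nrm_nonneg[of "real (Suc n)"] by smt
    then show ?thesis using one nrm_le_half[of "real (Suc n)"] L by auto
  next
    case False
    then have pos: "0 < nrm (real n)" using nrm_nonneg[of "real n"] by linarith
    have one_half: "1 < L / 2" using L by simp
    show ?thesis
      by (rule nrm_Suc_cases[OF L(1), of n]; simp only:)
        (intro conjI ball_map_add ball_map_diff ball_map_complement dense one one_half
          Suc.IH[THEN conjunct1] Suc.IH[THEN conjunct2] half pos nrm_nonneg zero_less_one zero_le_one)+
  qed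
qed

text \<open>Below \<open>L / 2\<close> some preserved radius lies just above any given distance, so
  distances do not increase; at \<open>L / 2\<close> this is clear since no distance is larger.
  Exchanging \<open>x\<close> and \<open>y\<close> gives equality.\<close>

lemma ball_map_one_imp_isometric:
  fixes I :: "'i set"
  assumes L: "2 < L" "L \<notin> \<rat>" and dense: "dense_family I x" "dense_family I y"
    and one: "ball_map I x y 1" "ball_map I y x 1"
    and ij: "i \<in> I" "j \<in> I"
  shows "nrm (x i - x j) = nrm (y i - y j)"
proof -
  have "nrm (y i - y j) \<le> nrm (x i - x j)"
    if "\<And>n. ball_map I x y (nrm (real n))" for x y :: "'i \<Rightarrow> real"
  proof (cases "nrm (x i - x j) < L / 2")
    case True
    show ?thesis
    proof (rule field_le_epsilon)
      fix \<epsilon> :: real assume "0 < \<epsilon>"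
      then obtain n where n: "nrm (x i - x j) < nrm (real n)" "nrm (real n) < nrm (x i - x j) + \<epsilon>"
        using nrm_approx[OF L(2) nrm_nonneg True] by blast
      from ball_mapD[OF that ij n(1)] n(2)
      show "nrm (y i - y j) \<le> nrm (x i - x j) + \<epsilon>" by simp
    qed
  next
    case False
    then show ?thesis using nrm_le_half[of "y i - y j"] by simp
  qed
  with ball_map_nrm_of_nat[OF L dense one] show ?thesis by (meson order_antisym)
qed

text \<open>Finite subsets of the unit ball around \<open>x i\<close> have common neighbours, so by compactness the
  image of that ball lies in a single closed unit ball. Its centre is \<open>y i\<close>, because the images of
  the neighbours of \<open>i\<close> are already dense in the unit ball around \<open>y i\<close>.\<close>

lemma adjacency_imp_ball_map_one:
  assumes L: "2 < L" and y_range: "y ` I \<subseteq> circle L" and y: "dense_family I y"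
    and adj_x: "\<And>i j. i \<in> I \<Longrightarrow> j \<in> I \<Longrightarrow> E i j \<Longrightarrow> nrm (x i - x j) < 1"
    and adj_y: "\<And>i j. i \<in> I \<Longrightarrow> j \<in> I \<Longrightarrow> E i j \<Longrightarrow> nrm (y i - y j) < 1"
    and common: "\<And>A i. finite A \<Longrightarrow> A \<subseteq> I \<Longrightarrow> i \<in> I \<Longrightarrow> (\<And>a. a \<in> A \<Longrightarrow> nrm (x a - x i) < 1)
                   \<Longrightarrow> \<exists>k\<in>I. \<forall>a\<in>A. E k a"
    and approx: "\<And>i j \<epsilon>. i \<in> I \<Longrightarrow> j \<in> I \<Longrightarrow> nrm (y i - y j) < 1 \<Longrightarrow> 0 < \<epsilon>
                   \<Longrightarrow> \<exists>k\<in>I. E k i \<and> nrm (y j - y k) < \<epsilon>"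
  shows "ball_map I x y 1"
  unfolding ball_map_def
proof (intro ballI impI)
  fix i j assume ij: "i \<in> I" "j \<in> I" "nrm (x i - x j) < 1"
  define B where "B = {a \<in> I. nrm (x a - x i) < 1}"
  \<comment> \<open>The closed interval replaces the half-open \<open>circle L\<close> to have a
    compact set. For finitely many constraints the image of a common neighbour is a
    solution.\<close>
  have "{0..L} \<inter> (\<Inter>a\<in>B. {q. nrm (y a - q) \<le> 1}) \<noteq> {}"
  proof (rule compact_imp_fip_image)
    fix a
    have "continuous_on UNIV (\<lambda>q. nrm (y a - q))"
      by (intro continuous_on_compose2[OF continuous_on_nrm[of UNIV]] continuous_intros) auto
    then show "closed {q. nrm (y a - q) \<le> 1}"
      by (intro closed_Collect_le continuous_intros) auto
  next
    fix A assume A: "finite A" "A \<subseteq> B"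
    then obtain k where k: "k \<in> I" "\<forall>a\<in>A. E k a"
      using common[of A i] ij by (auto simp: B_def subset_iff)
    have "y k \<in> {0..L}" using y_range k by (auto simp: circle_def)
    moreover have "nrm (y a - y k) \<le> 1" if "a \<in> A" for a
      using adj_y[of k a] k A that nrm_minus_commute[of "y a"] by (auto simp: B_def)
    ultimately show "{0..L} \<inter> (\<Inter>a\<in>A. {q. nrm (y a - q) \<le> 1}) \<noteq> {}" by blast
  qed simp
  then obtain q where q: "\<And>a. a \<in> B \<Longrightarrow> nrm (y a - q) \<le> 1" by blast
  have "nrm (q - y i) = 0"
  proof (rule ccontr)
    assume "nrm (q - y i) \<noteq> 0"
    then obtain w where w: "nrm (y i - w) < 1" "1 < nrm (q - w)"
      using nrm_ball_inj[of q "y i"] L by auto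
    \<comment> \<open>Half of the available slack, because \<open>w\<close> is approximated twice:
      by some \<open>y l\<close>, and then \<open>y l\<close> by the image of a neighbour of
      \<open>i\<close>.\<close>
    define \<epsilon> where "\<epsilon> = min (1 - nrm (y i - w)) (nrm (q - w) - 1) / 2"
    have \<epsilon>: "0 < \<epsilon>" "nrm (y i - w) + 2 * \<epsilon> \<le> 1" "1 + 2 * \<epsilon> \<le> nrm (q - w)"
      using w by (auto simp: \<epsilon>_def min_def)
    obtain l where l: "l \<in> I" "nrm (w - y l) < \<epsilon>" using y \<epsilon>(1) by (blast elim: dense_familyD)
    have "nrm (y i - y l) < 1"
      using nrm_triangle3[of "y i" "y l" w] l \<epsilon> by linarith
    then obtain k where k: "k \<in> I" "E k i" "nrm (y l - y k) < \<epsilon>"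
      using approx[OF ij(1) l(1) _ \<epsilon>(1)] by blast
    have "k \<in> B" using k ij adj_x by (auto simp: B_def)
    then have "nrm (y k - q) \<le> 1" by (rule q)
    then have "nrm (q - w) < 1 + 2 * \<epsilon>"
      using nrm_triangle3[of q w "y k"] nrm_triangle3[of "y k" w "y l"] l k
        nrm_minus_commute[of w "y l"] nrm_minus_commute[of q "y k"] nrm_minus_commute[of "y k" "y l"]
      by linarith
    with \<epsilon> show False by simp
  qed
  moreover have "nrm (y j - q) \<le> 1"
    using ij by (intro q) (auto simp: B_def nrm_minus_commute)
  ultimately show "nrm (y i - y j) \<le> 1"
    using nrm_triangle3[of "y j" "y i" q] nrm_minus_commute[of "y i" "y j"] by simp
qed

section \<open>Extension of an isometry from a dense subset to the circle\<close>

lemma isometric_imp_circle_isometry: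
  assumes S: "S \<subseteq> circle L" "dense_family S (\<lambda>v. v)" and f: "f ` S \<subseteq> circle L"
    and iso: "\<And>u v. u \<in> S \<Longrightarrow> v \<in> S \<Longrightarrow> nrm (f u - f v) = nrm (u - v)"
  shows "\<exists>\<phi>. circle_isometry L \<phi> \<and> (\<forall>v\<in>S. \<phi> v = f v)"
proof -
  obtain a where a: "a \<in> S" using dense_familyD[OF S(2), of 1 0] by auto
  \<comment> \<open>Being close to a quarter turn from \<open>a\<close>, the point \<open>b\<close>
    is neither \<open>a\<close> nor its antipode, so it can fix an orientation.\<close>
  obtain b where b: "b \<in> S" "nrm (a + L / 4 - b) < L / 4"
    using dense_familyD[OF S(2), of "L / 4" "a + L / 4"] L_pos by auto
  have L4: "nrm (L / 4) = L / 4" using L_pos by (subst nrm_eq_abs) auto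
  have ab_pos: "0 < nrm (b - a)"
    using nrm_triangle[of "a + L / 4 - b" "b - a"] b L4 by simp
  have ab_less: "nrm (b - a) < L / 2"
    using nrm_triangle[of "b - a - L / 4" "L / 4"] b L4
      nrm_minus_commute[of "b - a" "L / 4"] by (simp add: algebra_simps)
  have "nrm (f b - f a) = nrm (b - a)" using iso a b by simp
  \<comment> \<open>The sign \<open>s\<close> records whether \<open>f\<close> preserves or reverses
    orientation, as seen on the pair \<open>a\<close>, \<open>b\<close>.\<close>
  from nrm_eq_imp_rcong[OF this]
  obtain s :: real where s: "s = 1 \<or> s = - 1" "[s * (f b - f a) = b - a] (rmod L)"
  proof
    assume "[f b - f a = - (b - a)] (rmod L)"
    then have "[- (f b - f a) = b - a] (rmod L)" by (metis minus_minus rcong_uminus)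
    then show ?thesis using that[of "- 1"] by simp
  qed (use that[of 1] in simp)
  have cong_scale: "[s * x = s * y] (rmod L)" if "[x = y] (rmod L)" for x y
    using s(1) that by (auto simp only: mult_1 mult_minus1 rcong_uminus_uminus_iff)
  \<comment> \<open>The sign found at \<open>b\<close> works for every \<open>v\<close>. Otherwise
    preservation of the distance from \<open>v\<close> to \<open>b\<close> forces \<open>X\<close>
    or \<open>Y\<close> to be congruent to its negative: in the first case the two signs agree at
    \<open>v\<close>, and the second would make \<open>b\<close> equal or antipodal to
    \<open>a\<close>.\<close>
  have cong: "[s * (f v - f a) = v - a] (rmod L)" if v: "v \<in> S" for v
  proof (rule ccontr)
    assume no: "\<not> [s * (f v - f a) = v - a] (rmod L)"
    define X where "X = v - a"
    define Y where "Y = b - a"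
    have "nrm (s * (f v - f a)) = nrm X"
      using s(1) iso[of v a] a v nrm_minus_commute[of "f v" "f a"] by (auto simp: X_def)
    with no have flip: "[s * (f v - f a) = - X] (rmod L)"
      using nrm_eq_imp_rcong[of "s * (f v - f a)" X] by (auto simp: X_def)
    have "nrm (X - Y) = nrm (f v - f b)" using iso v b by (simp add: X_def Y_def)
    also have "\<dots> = nrm (s * (f v - f a) - s * (f b - f a))"
      using s(1) nrm_minus_commute[of "f v" "f b"] by (auto simp: algebra_simps)
    also have "\<dots> = nrm (- X - Y)"
      using flip s(2) by (intro nrm_rcong rcong_diff) (auto simp: Y_def)
    finally have "[- X - Y = X - Y] (rmod L) \<or> [- X - Y = - (X - Y)] (rmod L)"
      using nrm_eq_imp_rcong by metis
    then show False
    proof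
      assume "[- X - Y = X - Y] (rmod L)"
      then have "[- X = X] (rmod L)" by simp
      with flip no show False by (auto simp: X_def dest: rcong_trans)
    next
      assume "[- X - Y = - (X - Y)] (rmod L)"
      then have "[- X - Y = - X + Y] (rmod L)" by simp
      then have "[- Y = Y] (rmod L)" by (simp only: diff_conv_add_uminus rcong_add_left_cancel)
      then obtain n where "Y = - Y + of_int n * L" by (auto simp: rcong_altdef)
      then have n: "Y = of_int n * L / 2" by simp
      show False
      proof (cases "even n")
        case True
        then obtain m where "n = 2 * m" by blast
        then have "nrm Y \<le> 0" using nrm_le[of Y m] n by simp
        with ab_pos show False by (simp add: Y_def)
      next
        case False
        then obtain m where m: "n = 2 * m + 1" by (auto elim: oddE)
        have "nrm Y = nrm (L / 2)"
          by (intro nrm_rcong)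
            (auto simp: rcong_altdef n m algebra_simps add_divide_distrib intro!: exI[of _ "- m"])
        also have "\<dots> = L / 2" using L_pos by (subst nrm_eq_abs) auto
        finally show False using ab_less by (simp add: Y_def)
      qed
    qed
  qed
  \<comment> \<open>A rotation for \<open>s = 1\<close> and a reflection for
    \<open>s = - 1\<close>.\<close>
  define \<phi> where "\<phi> = (\<lambda>x. (f a + s * (x - a)) rmod L)"
  have nrm_scale: "nrm (s * x) = nrm x" for x using s(1) by auto
  have dist: "nrm (\<phi> u - \<phi> v) = nrm (u - v)" for u v
  proof -
    have "nrm (\<phi> u - \<phi> v) = nrm ((f a + s * (u - a)) - (f a + s * (v - a)))"
      unfolding \<phi>_def by (intro nrm_rcong rcong_diff rcong_rmod_left) auto
    also have "\<dots> = nrm (s * (u - v))" by (simp add: algebra_simps)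
    finally show ?thesis by (simp add: nrm_scale)
  qed
  have inj: "inj_on \<phi> (circle L)"
  proof (rule inj_onI)
    fix u v assume uv: "u \<in> circle L" "v \<in> circle L" "\<phi> u = \<phi> v"
    then have "nrm (u - v) = 0" using dist[of u v] by simp
    then have "[u - v + v = 0 + v] (rmod L)" by (simp only: nrm_eq_0_iff rcong_add_right_cancel)
    with uv show "u = v" by (auto intro: circle_rcong_imp_eq)
  qed
  have surj: "y \<in> \<phi> ` circle L" if y: "y \<in> circle L" for y
  proof -
    \<comment> \<open>Since \<open>s * s = 1\<close>, the inverse has the same form with
      \<open>a\<close> and \<open>f a\<close> exchanged.\<close>
    define x where "x = (a + s * (y - f a)) rmod L"
    have "nrm (\<phi> x - y) = nrm (f a + s * ((a + s * (y - f a)) - a) - y)"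
    proof (intro nrm_rcong rcong_diff rcong_refl)
      have "[x - a = (a + s * (y - f a)) - a] (rmod L)"
        unfolding x_def by (intro rcong_diff rcong_rmod_left rcong_refl)
      then have "[s * (x - a) = s * ((a + s * (y - f a)) - a)] (rmod L)"
        by (rule cong_scale)
      then show "[\<phi> x = f a + s * ((a + s * (y - f a)) - a)] (rmod L)"
        unfolding \<phi>_def by (intro rcong_rmod_left rcong_add rcong_refl)
    qed
    also have "\<dots> = 0" using s(1) by (auto simp: algebra_simps)
    finally have "[\<phi> x - y + y = 0 + y] (rmod L)"
      by (simp only: nrm_eq_0_iff rcong_add_right_cancel)
    then have "\<phi> x = y"
      using y rmod_in_circle by (intro circle_rcong_imp_eq) (auto simp: \<phi>_def)
    then show ?thesis by (metis imageI rmod_in_circle x_def)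
  qed
  have "circle_isometry L \<phi>"
    unfolding circle_isometry_def
  proof (intro conjI ballI)
    show "bij_betw \<phi> (circle L) (circle L)"
      unfolding bij_betw_def using inj surj rmod_in_circle by (auto simp: \<phi>_def)
  next
    fix u v assume "u \<in> circle L" "v \<in> circle L"
    moreover have "\<phi> u \<in> circle L" "\<phi> v \<in> circle L" by (simp_all add: \<phi>_def rmod_in_circle)
    ultimately show "circle_dist L (\<phi> u) (\<phi> v) = circle_dist L u v"
      by (simp add: circle_dist_eq_nrm dist)
  qed
  moreover have "\<phi> v = f v" if v: "v \<in> S" for v
  proof (rule circle_rcong_imp_eq)
    have "[s * (v - a) = s * (s * (f v - f a))] (rmod L)"
      by (intro cong_scale rcong_sym[OF cong[OF v]])
    moreover have "s * (s * (f v - f a)) = f v - f a" using s(1) by auto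
    ultimately have "[f a + s * (v - a) = f a + (f v - f a)] (rmod L)"
      by (intro rcong_add) auto
    then show "[\<phi> v = f v] (rmod L)"
      unfolding \<phi>_def by (intro rcong_rmod_left) simp
  qed (use f v rmod_in_circle in \<open>auto simp: \<phi>_def\<close>)
  ultimately show ?thesis by blast
qed

end

section \<open>Common neighbours in the random graph\<close>

context prob_space
begin

lemma indep_events_prob_INT:
  "indep_events X E \<Longrightarrow> J \<subseteq> E \<Longrightarrow> finite J \<Longrightarrow> J \<noteq> {} \<Longrightarrow> prob (\<Inter>e\<in>J. X e) = (\<Prod>e\<in>J. prob (X e))"
  by (simp add: indep_events_def)

lemma indep_events_blocks:
  assumes X: "indep_events X E"
    and B: "\<And>n. n \<in> I \<Longrightarrow> finite (B n) \<and> B n \<noteq> {} \<and> B n \<subseteq> E" "disjoint_family_on B I"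
  shows "indep_events (\<lambda>n. \<Inter>e\<in>B n. X e) I"
proof (rule indep_eventsI)
  fix n assume "n \<in> I"
  with X B(1) show "(\<Inter>e\<in>B n. X e) \<in> events"
    by (intro sets.finite_INT) (auto simp: indep_events_def subset_iff)
next
  fix J assume J: "J \<subseteq> I" "finite J" "J \<noteq> {}"
  have "(\<Inter>n\<in>J. \<Inter>e\<in>B n. X e) = (\<Inter>e\<in>(\<Union>n\<in>J. B n). X e)" by auto
  also have "prob \<dots> = (\<Prod>e\<in>(\<Union>n\<in>J. B n). prob (X e))"
    by (intro indep_events_prob_INT[OF X]) (use J B(1) in blast)+
  also have "\<dots> = (\<Prod>n\<in>J. \<Prod>e\<in>B n. prob (X e))"
    using J B disjoint_family_on_mono[OF J(1) B(2)]
    by (intro prod.UNION_disjoint) (auto simp: disjoint_family_on_def)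
  also have "\<dots> = (\<Prod>n\<in>J. prob (\<Inter>e\<in>B n. X e))"
  proof (rule prod.cong[OF refl])
    fix n assume "n \<in> J"
    with J B(1) have "finite (B n)" "B n \<noteq> {}" "B n \<subseteq> E" by auto
    then show "(\<Prod>e\<in>B n. prob (X e)) = prob (\<Inter>e\<in>B n. X e)"
      by (intro indep_events_prob_INT[OF X, symmetric])
  qed
  finally show "prob (\<Inter>n\<in>J. \<Inter>e\<in>B n. X e) = (\<Prod>n\<in>J. prob (\<Inter>e\<in>B n. X e))" .
qed

text \<open>Every tail union has probability at least \<open>q\<close>, hence so has the event that
  infinitely many \<open>F n\<close> occur. The zero-one law raises this positive probability to
  1.\<close>

lemma indep_events_AE_occurs:
  fixes F :: "nat \<Rightarrow> 'a set"
  assumes F: "indep_events F UNIV" and q: "0 < q" "\<And>n. q \<le> prob (F n)"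
  shows "AE \<omega> in M. \<exists>n. \<omega> \<in> F n"
proof -
  have ev [measurable]: "F n \<in> events" for n using F by (auto simp: indep_events_def)
  have "(\<lambda>n. prob (\<Union>m\<in>{n..}. F m)) \<longlonglongrightarrow> prob (\<Inter>n. \<Union>m\<in>{n..}. F m)"
    by (intro finite_Lim_measure_decseq) (auto simp: decseq_def intro: order_trans)
  moreover have "q \<le> prob (\<Union>m\<in>{n..}. F m)" for n
    by (rule order_trans[OF q(2)[of n]]) (auto intro!: finite_measure_mono)
  ultimately have "q \<le> prob (\<Inter>n. \<Union>m\<in>{n..}. F m)"
    by (intro LIMSEQ_le_const) auto
  with q(1) borel_0_1_law[OF F] have "prob (\<Inter>n. \<Union>m\<in>{n..}. F m) = 1" by auto
  then have "AE \<omega> in M. \<omega> \<in> (\<Inter>n. \<Union>m\<in>{n..}. F m)"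
    by (subst (asm) prob_eq_1) auto
  then show ?thesis by (rule AE_mp) (auto intro!: AE_I2)
qed

end

text \<open>A set of positive outer measure is not contained in a null set. No measurability of
  \<open>P\<close> is assumed, as the isomorphism event requires.\<close>

lemma outer_measure_pos_imp_ex:
  assumes "0 < outer_measure_of M {\<omega> \<in> space M. P \<omega>}" "AE \<omega> in M. Q \<omega>"
  obtains \<omega> where "\<omega> \<in> space M" "P \<omega>" "Q \<omega>"
proof -
  from assms(2) obtain N where N: "{\<omega> \<in> space M. \<not> Q \<omega>} \<subseteq> N" "N \<in> null_sets M"
    by (auto elim!: AE_E)
  have "outer_measure_of M N = 0" using N(2) by (simp add: null_sets_def)
  with assms(1) have "\<not> {\<omega> \<in> space M. P \<omega>} \<subseteq> N"
    using outer_measure_of_mono[of "{\<omega> \<in> space M. P \<omega>}" N M] by auto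
  with N(1) that show ?thesis by blast
qed

section \<open>Almost sure common neighbours near every vertex\<close>

context circle_length
begin

text \<open>Otherwise let \<delta> be the least positive distance from \<open>x\<close> to a point
  of the ball, capped by \<epsilon> and \<open>L / 2\<close>. A point of \<open>S\<close> within
  \<delta> / 2 of x + \<delta> / 2 has distance strictly between 0 and \<delta> from
  \<open>x\<close>, a contradiction.\<close>

lemma infinite_dense_ball:
  assumes S: "dense_family S (\<lambda>v. v)" and eps: "0 < \<epsilon>"
  shows "infinite {w \<in> S. nrm (x - w) < \<epsilon>}"
proof
  assume "finite {w \<in> S. nrm (x - w) < \<epsilon>}"
  then have fin: "finite (insert (min \<epsilon> (L / 2)) ((\<lambda>w. nrm (x - w)) ` {w \<in> S. nrm (x - w) < \<epsilon> \<and> 0 < nrm (x - w)}))"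
    (is "finite ?D") by (auto elim: rev_finite_subset)
  define \<delta> where "\<delta> = Min ?D"
  have \<delta>_le: "\<delta> \<le> d" if "d \<in> ?D" for d
    unfolding \<delta>_def using fin that by (rule Min_le)
  have "\<delta> \<in> ?D" unfolding \<delta>_def using fin by (intro Min_in) auto
  then have pos: "0 < \<delta>" using eps L_pos by auto
  have le: "\<delta> \<le> \<epsilon>" "\<delta> \<le> L / 2" using \<delta>_le[of "min \<epsilon> (L / 2)"] by auto
  obtain w where w: "w \<in> S" "nrm (x + \<delta> / 2 - w) < \<delta> / 2"
    using dense_familyD[OF S, of "\<delta> / 2"] pos by auto
  have half: "nrm (\<delta> / 2) = \<delta> / 2" using pos le by (subst nrm_eq_abs) auto
  have "nrm (x - w) < \<delta>"
    using nrm_triangle[of "x + \<delta> / 2 - w" "- (\<delta> / 2)"] w half by simp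
  moreover have "0 < nrm (x - w)"
    using nrm_triangle[of "x + \<delta> / 2 - w" "- (x - w)"] w half
      nrm_minus_commute[of x w] by simp
  ultimately show False
    using \<delta>_le[of "nrm (x - w)"] w le by auto
qed

lemma dense_in_circle_imp_dense_family:
  assumes "dense_in_circle L S" shows "dense_family S (\<lambda>v. v)"
  unfolding dense_family_def
proof (intro allI impI)
  fix z \<epsilon> :: real assume "0 < \<epsilon>"
  with assms obtain s where s: "s \<in> S" "circle_dist L (z rmod L) s < \<epsilon>"
    unfolding dense_in_circle_def using rmod_in_circle by blast
  then have "nrm (z rmod L - s) < \<epsilon>"
    using circle_dist_eq_nrm[of "z rmod L" s] rmod_in_circle[of z] assms
    by (auto simp: dense_in_circle_def)
  moreover have "nrm (z - s) = nrm (z rmod L - s)"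
    by (intro nrm_rcong rcong_diff) auto
  ultimately show "\<exists>i\<in>S. nrm (z - i) < \<epsilon>" using s(1) by (intro bexI[of _ s]) simp_all
qed

text \<open>The only almost sure property of the random graphs that the deterministic part
  uses.\<close>

definition locally_extendable :: "real graph \<Rightarrow> bool" where
  "locally_extendable H \<longleftrightarrow>
     (\<forall>A x \<epsilon>. finite A \<longrightarrow> A \<subseteq> verts H \<longrightarrow> x \<in> verts H \<longrightarrow> 0 < \<epsilon> \<longrightarrow>
        (\<forall>a\<in>A. nrm (x - a) < 1) \<longrightarrow>
        (\<exists>w\<in>verts H. nrm (x - w) < \<epsilon> \<and> (\<forall>a\<in>A. {w, a} \<in> edges H)))"

text \<open>Infinitely many candidates near \<open>x\<close> are each joined to all of
  \<open>A\<close> with the same positive probability \<open>p ^ card A\<close>. These events depend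
  on disjoint sets of edges, so almost surely one of them occurs.\<close>

lemma geometric_random_graph_AE_common_neighbour:
  assumes S: "dense_in_circle L S" and p: "0 < p"
    and G: "geometric_random_graph M L S p G"
    and A: "finite A" "A \<subseteq> S" "\<And>a. a \<in> A \<Longrightarrow> nrm (x - a) < 1" and eps: "0 < \<epsilon>"
  shows "AE \<omega> in M. \<exists>w\<in>S. nrm (x - w) < \<epsilon> \<and> (\<forall>a\<in>A. {w, a} \<in> edges (G \<omega>))"
proof (cases "A = {}")
  case True
  then show ?thesis
    using dense_in_circle_imp_dense_family[OF S] eps by (auto elim!: dense_familyD[of S _ \<epsilon> x])
next
  case A_nonempty: False
  interpret prob_space M using G by (simp add: geometric_random_graph_def)
  define X where "X e = {\<omega> \<in> space M. e \<in> edges (G \<omega>)}" for e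
  have X: "indep_events X (close_pairs L S)" and
    X_prob: "\<And>e. e \<in> close_pairs L S \<Longrightarrow> prob (X e) = p"
    using G by (simp_all add: geometric_random_graph_def X_def[abs_def])
  \<comment> \<open>Candidates within \<delta> of \<open>x\<close> are within \<epsilon> of
    \<open>x\<close> and at distance less than 1 from every point of \<open>A\<close>.\<close>
  define \<delta> where "\<delta> = Min (insert \<epsilon> ((\<lambda>a. 1 - nrm (x - a)) ` A))"
  have \<delta>: "0 < \<delta>" "\<delta> \<le> \<epsilon>" "\<And>a. a \<in> A \<Longrightarrow> \<delta> \<le> 1 - nrm (x - a)"
    using A eps by (auto simp: \<delta>_def)
  \<comment> \<open>Removing \<open>A\<close> excludes loops and makes the edge blocks of different
    candidates disjoint: a shared edge would put a candidate into \<open>A\<close>.\<close>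
  have "infinite ({w \<in> S. nrm (x - w) < \<delta>} - A)"
    using infinite_dense_ball[OF dense_in_circle_imp_dense_family[OF S] \<delta>(1)] A(1) by simp
  then obtain w :: "nat \<Rightarrow> real" where w: "inj w" "range w \<subseteq> {w \<in> S. nrm (x - w) < \<delta>} - A"
    using infinite_countable_subset by blast
  define B where "B n = (\<lambda>a. {w n, a}) ` A" for n
  have w_in: "w n \<in> S" "nrm (x - w n) < \<delta>" "w n \<notin> A" for n using w(2) by auto
  have close: "{w n, a} \<in> close_pairs L S" if "a \<in> A" for n a
  proof -
    have "nrm (w n - a) < 1"
      using nrm_triangle3[of "w n" a x] w_in(2)[of n] \<delta>(3)[OF that] nrm_minus_commute[of x "w n"]
      by simp
    moreover have "w n \<in> circle L" "a \<in> circle L"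
      using S w_in A that by (auto simp: dense_in_circle_def)
    ultimately have "circle_dist L (w n) a < 1" by (simp add: circle_dist_eq_nrm)
    moreover have "w n \<noteq> a" using w_in that by auto
    ultimately show ?thesis
      unfolding close_pairs_def using w_in A that by blast
  qed
  have indep: "indep_events (\<lambda>n. \<Inter>e\<in>B n. X e) UNIV"
  proof (rule indep_events_blocks[OF X])
    show "disjoint_family_on B UNIV"
      using w_in(3) inj_eq[OF w(1)] unfolding disjoint_family_on_def B_def
      by (auto simp: doubleton_eq_iff)
  qed (use A A_nonempty close in \<open>auto simp: B_def\<close>)
  have "prob (\<Inter>e\<in>B n. X e) = p ^ card A" for n
  proof -
    have "prob (\<Inter>e\<in>B n. X e) = (\<Prod>e\<in>B n. prob (X e))"
      by (rule indep_events_prob_INT[OF X]) (use A(1) A_nonempty close in \<open>auto simp: B_def\<close>)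
    also have "\<dots> = (\<Prod>e\<in>B n. p)" using close by (intro prod.cong) (auto simp: B_def X_prob)
    also have "\<dots> = p ^ card A"
      by (auto simp: B_def doubleton_eq_iff inj_on_def intro!: arg_cong[where f = "power p"] card_image)
    finally show ?thesis .
  qed
  then have "AE \<omega> in M. \<exists>n. \<omega> \<in> (\<Inter>e\<in>B n. X e)"
    using p by (intro indep_events_AE_occurs[OF indep, of "p ^ card A"]) auto
  then show ?thesis
  proof (rule AE_mp, intro AE_I2 impI)
    fix \<omega> assume "\<exists>n. \<omega> \<in> (\<Inter>e\<in>B n. X e)"
    then obtain n where "\<omega> \<in> (\<Inter>e\<in>B n. X e)" by blast
    then have "\<forall>a\<in>A. {w n, a} \<in> edges (G \<omega>)" by (auto simp: B_def X_def)
    then show "\<exists>w\<in>S. nrm (x - w) < \<epsilon> \<and> (\<forall>a\<in>A. {w, a} \<in> edges (G \<omega>))"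
      using w_in[of n] \<delta>(2) by (intro bexI[of _ "w n"]) auto
  qed
qed

text \<open>Finite subsets of \<open>S\<close>, centres in \<open>S\<close> and radii
  \<open>1 / real (Suc n)\<close> form countably many instances, so their exceptional null sets can
  be united.\<close>

lemma geometric_random_graph_AE_locally_extendable:
  assumes S: "countable S" "dense_in_circle L S" and p: "0 < p"
    and G: "geometric_random_graph M L S p G"
  shows "AE \<omega> in M. locally_extendable (G \<omega>)"
proof -
  define T where "T = {(A, x). finite A \<and> A \<subseteq> S \<and> x \<in> S \<and> (\<forall>a\<in>A. nrm (x - a) < 1)}"
  have "countable ({A. finite A \<and> A \<subseteq> S} \<times> S)"
    using S(1) by (intro countable_SIGMA countable_Collect_finite_subset)
  then have T: "countable T" by (rule countable_subset[rotated]) (auto simp: T_def)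
  have "AE \<omega> in M. \<forall>t\<in>T. \<forall>n::nat. \<exists>w\<in>S. nrm (snd t - w) < 1 / real (Suc n) \<and>
      (\<forall>a\<in>fst t. {w, a} \<in> edges (G \<omega>))"
    unfolding AE_ball_countable[OF T] AE_all_countable
  proof (intro ballI allI)
    fix t n assume "t \<in> T"
    then show "AE \<omega> in M. \<exists>w\<in>S. nrm (snd t - w) < 1 / real (Suc n) \<and>
        (\<forall>a\<in>fst t. {w, a} \<in> edges (G \<omega>))"
      by (intro geometric_random_graph_AE_common_neighbour[OF S(2) p G]) (auto simp: T_def)
  qed
  then show ?thesis
  proof (rule AE_mp, intro AE_I2 impI)
    fix \<omega> assume \<omega>: "\<omega> \<in> space M" and *: "\<forall>t\<in>T. \<forall>n::nat. \<exists>w\<in>S. nrm (snd t - w) < 1 / real (Suc n) \<and>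
      (\<forall>a\<in>fst t. {w, a} \<in> edges (G \<omega>))"
    have verts: "verts (G \<omega>) = S" using G \<omega> by (auto simp: geometric_random_graph_def)
    show "locally_extendable (G \<omega>)"
      unfolding locally_extendable_def verts
    proof (intro allI impI)
      fix A x and \<epsilon> :: real
      assume A: "finite A" "A \<subseteq> S" "x \<in> S" "0 < \<epsilon>" "\<forall>a\<in>A. nrm (x - a) < 1"
      obtain n where n: "1 / real (Suc n) < \<epsilon>" using nat_approx_posE A(4) by metis
      from A have "(A, x) \<in> T" by (auto simp: T_def)
      with * obtain w where "w \<in> S" "nrm (x - w) < 1 / real (Suc n)" "\<forall>a\<in>A. {w, a} \<in> edges (G \<omega>)"
        by fastforce
      with n show "\<exists>w\<in>S. nrm (x - w) < \<epsilon> \<and> (\<forall>a\<in>A. {w, a} \<in> edges (G \<omega>))"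
        by (intro bexI[of _ w]) auto
    qed
  qed
qed

section \<open>The deterministic conclusion for one pair of isomorphic graphs\<close>

lemma graph_iso_imp_circle_isometry:
  assumes L: "2 < L" "L \<notin> \<rat>"
    and H: "dense_in_circle L (verts H)" "edges H \<subseteq> close_pairs L (verts H)" "locally_extendable H"
    and H': "dense_in_circle L (verts H')" "edges H' \<subseteq> close_pairs L (verts H')" "locally_extendable H'"
    and iso: "graph_iso H H'"
  shows "\<exists>\<phi>. circle_isometry L \<phi> \<and> \<phi> ` verts H = verts H'"
proof -
  obtain f where f: "bij_betw f (verts H) (verts H')"
    and edge: "\<And>u v. u \<in> verts H \<Longrightarrow> v \<in> verts H \<Longrightarrow> {u, v} \<in> edges H \<longleftrightarrow> {f u, f v} \<in> edges H'"
    using iso by (auto simp: graph_iso_def)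
  have img: "f ` verts H = verts H'" using f by (simp add: bij_betw_def)
  then have f_in: "f u \<in> verts H'" if "u \<in> verts H" for u using that by auto
  have circ: "verts H \<subseteq> circle L" "verts H' \<subseteq> circle L"
    using H(1) H'(1) by (auto simp: dense_in_circle_def)
  have adj: "nrm (u - v) < 1"
    if "edges K \<subseteq> close_pairs L (verts K)" "verts K \<subseteq> circle L" "{u, v} \<in> edges K"
    for u v and K :: "real graph"
  proof -
    have "{u, v} \<in> close_pairs L (verts K)" using that(1,3) by (rule subsetD)
    then obtain a b where "{u, v} = {a, b}" "a \<in> verts K" "b \<in> verts K" "circle_dist L a b < 1"
      by (auto simp: close_pairs_def)
    moreover from this have "a \<in> circle L" "b \<in> circle L" using that(2) by auto
    ultimately show ?thesis
      using nrm_minus_commute[of u v] by (auto simp: doubleton_eq_iff circle_dist_eq_nrm)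
  qed
  have ext: "\<exists>w\<in>verts H. nrm (x - w) < \<epsilon> \<and> (\<forall>a\<in>A. {w, a} \<in> edges H)"
    if "finite A" "A \<subseteq> verts H" "x \<in> verts H" "0 < \<epsilon>" "\<And>a. a \<in> A \<Longrightarrow> nrm (x - a) < 1" for A x \<epsilon>
    using H(3) that unfolding locally_extendable_def by blast
  \<comment> \<open>The extension property of \<open>H'\<close>, pulled back along \<open>f\<close>
    to the vertices and edges of \<open>H\<close>.\<close>
  have ext': "\<exists>w\<in>verts H. nrm (f x - f w) < \<epsilon> \<and> (\<forall>a\<in>A. {w, a} \<in> edges H)"
    if A: "finite A" "A \<subseteq> verts H" "x \<in> verts H" "0 < \<epsilon>" "\<And>a. a \<in> A \<Longrightarrow> nrm (f x - f a) < 1" for A x \<epsilon>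
  proof -
    have "finite (f ` A)" using A(1) by simp
    moreover have "f ` A \<subseteq> verts H'" using image_mono[OF A(2), of f] img by simp
    moreover have "nrm (f x - a) < 1" if "a \<in> f ` A" for a using A(5) that by blast
    ultimately have "\<exists>w'\<in>verts H'. nrm (f x - w') < \<epsilon> \<and> (\<forall>a\<in>f ` A. {w', a} \<in> edges H')"
      using f_in[OF A(3)] A(4) by (intro H'(3)[unfolded locally_extendable_def, rule_format])
    then obtain w' where w': "w' \<in> verts H'" "nrm (f x - w') < \<epsilon>" "\<forall>a\<in>f ` A. {w', a} \<in> edges H'"
      by blast
    then obtain w where w: "w \<in> verts H" "w' = f w" using img by blast
    have "{w, a} \<in> edges H" if "a \<in> A" for a
      using w' w edge[OF w(1), of a] A(2) that by blast
    with w w' show ?thesis by blast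
  qed
  have dense: "dense_family (verts H) (\<lambda>v. v)" using H(1) by (rule dense_in_circle_imp_dense_family)
  have dense': "dense_family (verts H) f"
    using dense_in_circle_imp_dense_family[OF H'(1)] unfolding dense_family_def img[symmetric] by simp
  \<comment> \<open>Common neighbours come from \<open>H\<close>, where any radius serves;
    neighbours with image near a given point come from \<open>H'\<close>, applied to a singleton.
    For \<open>one'\<close> the two graphs exchange roles.\<close>
  have one: "ball_map (verts H) (\<lambda>v. v) f 1"
  proof (rule adjacency_imp_ball_map_one[where E = "\<lambda>u v. {u, v} \<in> edges H"])
    fix A u assume "finite A" "A \<subseteq> verts H" "u \<in> verts H" "\<And>a. a \<in> A \<Longrightarrow> nrm (a - u) < 1"
    then show "\<exists>k\<in>verts H. \<forall>a\<in>A. {k, a} \<in> edges H"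
      using ext[of A u 1] nrm_minus_commute[of u] by auto
  next
    fix u v \<epsilon> assume "u \<in> verts H" "v \<in> verts H" "nrm (f u - f v) < 1" "(0::real) < \<epsilon>"
    then show "\<exists>k\<in>verts H. {k, u} \<in> edges H \<and> nrm (f v - f k) < \<epsilon>"
      using ext'[of "{u}" v \<epsilon>] nrm_minus_commute[of "f u" "f v"] by auto
  next
    fix u v assume "u \<in> verts H" "v \<in> verts H" "{u, v} \<in> edges H"
    then show "nrm (u - v) < 1" "nrm (f u - f v) < 1"
      by (simp_all add: edge adj[OF H(2) circ(1)] adj[OF H'(2) circ(2)])
  qed (use L(1) circ(2) img dense' in simp_all)
  have one': "ball_map (verts H) f (\<lambda>v. v) 1"
  proof (rule adjacency_imp_ball_map_one[where E = "\<lambda>u v. {u, v} \<in> edges H"])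
    fix A u assume "finite A" "A \<subseteq> verts H" "u \<in> verts H" "\<And>a. a \<in> A \<Longrightarrow> nrm (f a - f u) < 1"
    then show "\<exists>k\<in>verts H. \<forall>a\<in>A. {k, a} \<in> edges H"
      using ext'[of A u 1] nrm_minus_commute[of "f u"] by auto
  next
    fix u v \<epsilon> assume "u \<in> verts H" "v \<in> verts H" "nrm (u - v) < 1" "(0::real) < \<epsilon>"
    then show "\<exists>k\<in>verts H. {k, u} \<in> edges H \<and> nrm (v - k) < \<epsilon>"
      using ext[of "{u}" v \<epsilon>] nrm_minus_commute[of u v] by auto
  next
    fix u v assume "u \<in> verts H" "v \<in> verts H" "{u, v} \<in> edges H"
    then show "nrm (f u - f v) < 1" "nrm (u - v) < 1"
      by (simp_all add: edge adj[OF H(2) circ(1)] adj[OF H'(2) circ(2)])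
  qed (use L(1) circ(1) dense in simp_all)
  have "nrm (f u - f v) = nrm (u - v)" if "u \<in> verts H" "v \<in> verts H" for u v
    using ball_map_one_imp_isometric[OF L dense dense' one one' that] by simp
  then obtain \<phi> where "circle_isometry L \<phi>" "\<forall>v\<in>verts H. \<phi> v = f v"
    using isometric_imp_circle_isometry[OF circ(1) dense, of f] img circ(2) by auto
  then show ?thesis using img by (intro exI[of _ \<phi>]) auto
qed

end

theorem theorem1p3:
  fixes L p p' :: real and S S' :: "real set"
    and M :: "'w measure" and G G' :: "'w \<Rightarrow> real graph"
  assumes "L > 2" and "L \<notin> \<rat>"
    and "countable S" and "dense_in_circle L S"
    and "countable S'" and "dense_in_circle L S'"
    and "0 < p" and "p < 1" and "0 < p'" and "p' < 1"
    and "geometric_random_graph M L S p G"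
    and "geometric_random_graph M L S' p' G'"
    and "prob_iso M G G' > 0"
  shows "\<exists>\<phi>. circle_isometry L \<phi> \<and> \<phi> ` S = S'"
proof -
  interpret circle_length L using assms(1) by unfold_locales simp
  have "AE \<omega> in M. locally_extendable (G \<omega>)" "AE \<omega> in M. locally_extendable (G' \<omega>)"
    using assms by (auto intro: geometric_random_graph_AE_locally_extendable)
  then have "AE \<omega> in M. locally_extendable (G \<omega>) \<and> locally_extendable (G' \<omega>)" by simp
  \<comment> \<open>One outcome in the isomorphism event at which both graphs are locally extendable
    suffices; the rest is deterministic.\<close>
  with assms(13) obtain \<omega> where \<omega>: "\<omega> \<in> space M" "graph_iso (G \<omega>) (G' \<omega>)"
    "locally_extendable (G \<omega>)" "locally_extendable (G' \<omega>)"
    unfolding prob_iso_def by (rule outer_measure_pos_imp_ex) blast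
  have "verts (G \<omega>) = S" "edges (G \<omega>) \<subseteq> close_pairs L S"
    "verts (G' \<omega>) = S'" "edges (G' \<omega>) \<subseteq> close_pairs L S'"
    using assms(11,12) \<omega>(1) by (auto simp: geometric_random_graph_def)
  with graph_iso_imp_circle_isometry[OF assms(1,2), of "G \<omega>" "G' \<omega>"] \<omega> assms(4,6)
  show ?thesis by simp
qed

end
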